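(* Let $m_1,m_2$ be positive integers and let $P_1=(x_1,x_2)$, $P_2=(y_1,y_2)$ be points of $\mathcal{S}^2$. Then there exists an integer $k\ge 0$ with $F^k(P_1)=P_2$ if and only if there exist $j,k'\in\{0,1\}$ such that \[2\gcd(m_1,m_2)\ \Big|\ (x_2-x_1)+\big((-1)^{j}y_2+(-1)^{k'}y_1\big).\]
   Context: $\mathcal{S}^2=\{(x_1,x_2)\in\mathbb{Z}^2: 0\le x_i\le m_i,\ i=1,2\}$ is the set of points of the $m_1\times m_2$ plane grid. For a positive integer $m$ let $\varphi_m:\mathbb{Z}\to\{0,\dots,m\}$, $\varphi_m(u)=\min_{n\in\mathbb{Z}}|u-2nm|$ (so $\varphi_m(u)=u$ for $0\le u\le m$, and $\varphi_m$ is even and $2m$-periodic). For $k\in\mathbb{Z}$ put $f_i^k(x)=\varphi_{m_i}(x+k)$ for $x\in\{0,\dots,m_i\}$, and $F^k(x_1,x_2)=(f_1^k(x_1),f_2^k(x_2))$. Thus $F^k(P)$ is the position, after $k$ unit diagonal steps, of a light beam starting at $P$ in direction $(+1,+1)$ inside the rectangle $[0,m_1]\times[0,m_2]$ with mirror boundary; "the light starting from $P_1$ passes through $P_2$" means $F^k(P_1)=P_2$ for some $k\ge0$. *)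

theory Defs
  imports Complex_Main
begin

definition grid :: "int \<Rightarrow> int \<Rightarrow> (int \<times> int) set" where
  "grid m1 m2 = {0..m1} \<times> {0..m2}"

(* The minimum over all integers n. The set is infinite, so Min does not apply;
   it is a nonempty set of nonnegative integers, so LEAST denotes its minimum. *)
definition fold_refl :: "int \<Rightarrow> int \<Rightarrow> int" where
  "fold_refl m u = (LEAST v. v \<in> range (\<lambda>n::int. \<bar>u - 2 * n * m\<bar>))"

definition coord_pos :: "int \<Rightarrow> int \<Rightarrow> int \<Rightarrow> int" where
  "coord_pos m k x = fold_refl m (x + k)"

(* F^k, the light position after k unit diagonal steps from the given point;
   total on pairs of integers, but only meaningful on grid points. *)
definition light_pos :: "int \<Rightarrow> int \<Rightarrow> int \<Rightarrow> int \<times> int \<Rightarrow> int \<times> int" where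
  "light_pos m1 m2 k P = (coord_pos m1 k (fst P), coord_pos m2 k (snd P))"

end

theory Submission
  imports Defs
begin

text \<open>
  For \<open>y\<close> in \<open>{0..m}\<close>, the folded value of \<open>u\<close> is \<open>y\<close> exactly when \<open>u\<close> is congruent to \<open>y\<close> or
  \<open>- y\<close> modulo \<open>2 * m\<close>. Hence the light reaches \<open>(y1, y2)\<close> iff for some choice of signs the system
  of congruences of \<open>k\<close> to \<open>\<plusminus> y1 - x1\<close> modulo \<open>2 * m1\<close> and to \<open>\<plusminus> y2 - x2\<close> modulo \<open>2 * m2\<close> is
  solvable, and by the Chinese remainder theorem for arbitrary moduli this is the stated
  divisibility.
\<close>

text \<open>Writing \<open>u = s + 2 * m * q\<close> with \<open>s\<close> one of \<open>y\<close>,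
  \<open>- y\<close>, the choice \<open>n = q\<close> attains the value \<open>y\<close>, and no
  other \<open>n\<close> does better.\<close>

lemma fold_refl_eqI:
  fixes m u y :: int
  assumes y: "0 \<le> y" "y \<le> m" and dvd: "2 * m dvd u - y \<or> 2 * m dvd u + y"
  shows "fold_refl m u = y"
proof -
  obtain s q where s: "s = y \<or> s = - y" and u: "u = s + 2 * m * q"
    using dvd
  proof
    assume "2 * m dvd u - y"
    then obtain q where "u - y = 2 * m * q" ..
    then show ?thesis using that[of y q] by simp
  next
    assume "2 * m dvd u + y"
    then obtain q where "u + y = 2 * m * q" ..
    then show ?thesis using that[of "- y" q] by simp
  qed
  show ?thesis
    unfolding fold_refl_def
  proof (rule Least_equality)
    show "y \<in> range (\<lambda>n. \<bar>u - 2 * n * m\<bar>)"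
      by (rule range_eqI[of _ _ q]) (use s y in \<open>auto simp: u algebra_simps\<close>)
  next
    fix v
    assume "v \<in> range (\<lambda>n. \<bar>u - 2 * n * m\<bar>)"
    then obtain n where v: "v = \<bar>u - 2 * n * m\<bar>" by blast
    \<comment> \<open>A wrong \<open>n\<close> shifts \<open>s\<close> by at least
      \<open>2 * m\<close>, leaving absolute value at least \<open>2 * m - y\<close>, which is
      \<open>\<ge> y\<close> as \<open>y \<le> m\<close>.\<close>
    have "m * 1 \<le> m * \<bar>q - n\<bar>" if "q \<noteq> n"
      using that y by (intro mult_left_mono) auto
    then have "q = n \<or> m \<le> \<bar>m * (q - n)\<bar>"
      using y by (auto simp: abs_mult)
    moreover have "v = \<bar>s + 2 * (m * (q - n))\<bar>"
      by (simp add: v u algebra_simps)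
    ultimately show "y \<le> v"
      using s y by auto
  qed
qed

lemma fold_refl_eq_iff:
  fixes m u y :: int
  assumes m: "m > 0" and y: "0 \<le> y" "y \<le> m"
  shows "fold_refl m u = y \<longleftrightarrow> 2 * m dvd u - y \<or> 2 * m dvd u + y"
proof
  define r where "r = u mod (2 * m)"
  \<comment> \<open>A residue beyond \<open>m\<close> is reflected into \<open>{0..m}\<close>; then
    \<open>u\<close> is congruent to \<open>- z\<close>. The folded value is thus \<open>z\<close>,
    which forces \<open>y = z\<close>.\<close>
  define z where "z = (if r \<le> m then r else 2 * m - r)"
  have r: "0 \<le> r" "r < 2 * m" and dvd: "2 * m dvd u - r"
    using m by (auto simp: r_def dvd_minus_mod)
  have z: "2 * m dvd u - z \<or> 2 * m dvd u + z"
    using dvd dvd_add[OF dvd dvd_refl] by (auto simp: z_def algebra_simps)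
  then have "fold_refl m u = z"
    using r by (intro fold_refl_eqI) (auto simp: z_def)
  moreover assume "fold_refl m u = y"
  ultimately show "2 * m dvd u - y \<or> 2 * m dvd u + y"
    using z by simp
qed (rule fold_refl_eqI[OF y])

lemma nonneg_simultaneous_cong_iff:
  fixes m n a b :: int
  assumes "m > 0" "n > 0"
  shows "(\<exists>k\<ge>0. m dvd k - a \<and> n dvd k - b) \<longleftrightarrow> gcd m n dvd a - b"
proof
  assume "\<exists>k\<ge>0. m dvd k - a \<and> n dvd k - b"
  then obtain k where "m dvd k - a" "n dvd k - b" by blast
  then have "gcd m n dvd (k - b) - (k - a)"
    by (meson dvd_diff dvd_trans gcd_dvd1 gcd_dvd2)
  then show "gcd m n dvd a - b" by simp
next
  assume "gcd m n dvd a - b"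
  then obtain t where t: "a - b = gcd m n * t" ..
  obtain p q where bez: "p * m + q * n = gcd m n"
    using bezout_int by blast
  \<comment> \<open>Since \<open>a - b = (p * m + q * n) * t\<close>, this Bezout combination also
    equals \<open>b + n * (q * t)\<close>, so it solves both congruences.\<close>
  define c where "c = a - m * (p * t)"
  \<comment> \<open>A multiple of \<open>m * n\<close> preserves both congruences; this one is large
    enough to make \<open>k\<close> nonnegative.\<close>
  define k where "k = c + m * n * \<bar>c\<bar>"
  have "1 * \<bar>c\<bar> \<le> m * n * \<bar>c\<bar>"
    using mult_pos_pos[OF assms] by (intro mult_right_mono) auto
  then have "k \<ge> 0" unfolding k_def by linarith
  moreover have "k - a = m * (n * \<bar>c\<bar> - p * t)"
    by (simp add: k_def c_def algebra_simps)
  moreover have "c - b = n * (q * t)"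
    using t by (simp add: c_def algebra_simps flip: bez)
  then have "k - b = n * (m * \<bar>c\<bar> + q * t)"
    by (simp add: k_def algebra_simps)
  ultimately show "\<exists>k\<ge>0. m dvd k - a \<and> n dvd k - b" by auto
qed

theorem theorem3p4:
  fixes m1 m2 x1 x2 y1 y2 :: int
  assumes "m1 > 0" and "m2 > 0"
    and "(x1, x2) \<in> grid m1 m2" and "(y1, y2) \<in> grid m1 m2"
  shows "(\<exists>k::int. k \<ge> 0 \<and> light_pos m1 m2 k (x1, x2) = (y1, y2)) \<longleftrightarrow>
    (\<exists>j\<in>{0, 1::nat}. \<exists>k'\<in>{0, 1::nat}.
       2 * gcd m1 m2 dvd (x2 - x1) + ((-1) ^ j * y2 + (-1) ^ k' * y1))"
proof -
  have y: "0 \<le> y1" "y1 \<le> m1" "0 \<le> y2" "y2 \<le> m2"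
    using assms by (auto simp: grid_def)
  have hit: "light_pos m1 m2 k (x1, x2) = (y1, y2) \<longleftrightarrow>
      (\<exists>s\<in>{y1, - y1}. \<exists>t\<in>{y2, - y2}. 2 * m1 dvd k - (s - x1) \<and> 2 * m2 dvd k - (t - x2))" for k
    using y assms(1,2)
    by (auto simp: light_pos_def coord_pos_def fold_refl_eq_iff algebra_simps)
  have gcd: "gcd (2 * m1) (2 * m2) = 2 * gcd m1 m2"
    using gcd_mult_distrib_int[of 2 m1 m2] by simp
  have crt: "(\<exists>k\<ge>0. 2 * m1 dvd k - a \<and> 2 * m2 dvd k - b) \<longleftrightarrow> 2 * gcd m1 m2 dvd a - b" for a b
    using nonneg_simultaneous_cong_iff[of "2 * m1" "2 * m2" a b] assms(1,2) by (simp add: gcd)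
  have "(\<exists>k\<ge>0. light_pos m1 m2 k (x1, x2) = (y1, y2)) \<longleftrightarrow>
      (\<exists>s\<in>{y1, - y1}. \<exists>t\<in>{y2, - y2}.
        \<exists>k\<ge>0. 2 * m1 dvd k - (s - x1) \<and> 2 * m2 dvd k - (t - x2))"
    unfolding hit by blast
  also have "\<dots> \<longleftrightarrow> (\<exists>s\<in>{y1, - y1}. \<exists>t\<in>{y2, - y2}. 2 * gcd m1 m2 dvd (s - x1) - (t - x2))"
    unfolding crt ..
  \<comment> \<open>The difference is \<open>(x2 - x1) + (s - t)\<close>, and \<open>- t\<close>
    runs through the same two values as \<open>t\<close>.\<close>
  also have "\<dots> \<longleftrightarrow> (\<exists>j\<in>{0, 1::nat}. \<exists>k'\<in>{0, 1::nat}.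
       2 * gcd m1 m2 dvd (x2 - x1) + ((-1) ^ j * y2 + (-1) ^ k' * y1))"
    by (auto simp: algebra_simps)
  finally show ?thesis .
qed

end
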